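(* The function $$f(z)=\frac{c\,z^2}{(1-z)^2\log^2(1-z)},\qquad z\in D,$$ where the constant $c>0$ is chosen so that $\|f\|=1$, is not strongly exposed in the unit ball of $A^1$.
   Context: $D$ is the open unit disc in $\mathbb{C}$ and $dA=\frac1\pi r\,dr\,d\theta$ is normalized Lebesgue measure on $D$. The Bergman space $A^1$ is the Banach space of holomorphic functions $f$ on $D$ with $\|f\|=\int_D|f|\,dA<\infty$. $\log$ is the principal branch, $\log^2(1-z)=(\log(1-z))^2$, and the removable singularity of $f$ at $z=0$ is removed. For a Banach space $X$, a point $x\in X$ with $\|x\|=1$ is called strongly exposed (in the unit ball of $X$) if there is $L\in X^*$ with $L(x)=\|L\|=1$ such that for every sequence $(x_n)$ in the unit ball of $X$ with $\lim_{n\to\infty} L(x_n)=1$ one has $\|x_n-x\|\to0$. *)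

theory Defs
  imports "HOL-Complex_Analysis.Complex_Analysis"
begin

text \<open>
  The distribution only has real normed spaces, while the functionals below have to be
  complex linear; hence the following class.
\<close>

class complex_normed_vector = real_normed_vector +
  fixes scaleC :: "complex \<Rightarrow> 'a \<Rightarrow> 'a"  (infixr \<open>*\<^sub>C\<close> 75)
  assumes scaleC_add_right: "a *\<^sub>C (x + y) = a *\<^sub>C x + a *\<^sub>C y"
    and scaleC_add_left: "(a + b) *\<^sub>C x = a *\<^sub>C x + b *\<^sub>C x"
    and scaleC_scaleC: "a *\<^sub>C b *\<^sub>C x = (a * b) *\<^sub>C x"
    and scaleC_of_real: "complex_of_real r *\<^sub>C x = r *\<^sub>R x"
    and norm_scaleC: "norm (a *\<^sub>C x) = cmod a * norm x"

definition bounded_clinear_functional :: "('a::complex_normed_vector \<Rightarrow> complex) \<Rightarrow> bool" where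
  "bounded_clinear_functional L \<longleftrightarrow> bounded_linear L \<and> (\<forall>a x. L (a *\<^sub>C x) = a * L x)"

text \<open>Completeness of the space plays no role here and is therefore not part of the class.\<close>

definition strongly_exposed :: "'a::complex_normed_vector \<Rightarrow> bool" where
  "strongly_exposed x \<longleftrightarrow> norm x = 1 \<and>
     (\<exists>L. bounded_clinear_functional L \<and> L x = 1 \<and> onorm L = 1 \<and>
       (\<forall>u :: nat \<Rightarrow> 'a. (\<forall>n. norm (u n) \<le> 1) \<longrightarrow> (\<lambda>n. L (u n)) \<longlonglongrightarrow> 1 \<longrightarrow>
          (\<lambda>n. norm (u n - x)) \<longlonglongrightarrow> 0))"

text \<open>
  Elements of the Bergman space \<open>A\<^sup>1\<close> are represented by functions on the whole plane that
  vanish off the disc, so that equality of representatives is equality on the disc.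
\<close>

typedef bergman = "{f :: complex \<Rightarrow> complex.
    f holomorphic_on ball 0 1 \<and> set_integrable lborel (ball 0 1) f \<and> (\<forall>z. z \<notin> ball 0 1 \<longrightarrow> f z = 0)}"
  morphisms bergman_fun Abs_bergman
  by (rule exI[of _ "\<lambda>_. 0"]) (auto simp: set_integrable_def)

setup_lifting type_definition_bergman

lemma bergman_fun_holomorphic: "bergman_fun f holomorphic_on ball 0 1"
  and bergman_fun_integrable: "set_integrable lborel (ball 0 1) (bergman_fun f)"
  using bergman_fun[of f] by auto

lemma bergman_fun_integrable_norm: "set_integrable lborel (ball 0 1) (\<lambda>z. cmod (bergman_fun f z))"
  using set_integrable_norm[OF bergman_fun_integrable] .

lemma bergman_integral_eq_0D:
  assumes "(LINT z:ball 0 1|lborel. cmod (bergman_fun f z)) = 0"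
  shows "bergman_fun f z = 0"
proof (cases "z \<in> ball 0 1")
  case True
  have "AE z in lborel. indicator (ball 0 1) z *\<^sub>R cmod (bergman_fun f z) = 0"
    using assms bergman_fun_integrable_norm[of f]
    unfolding set_lebesgue_integral_def set_integrable_def
    by (subst (asm) integral_nonneg_eq_0_iff_AE) auto
  then have ae: "AE z in lborel. z \<in> ball 0 1 \<longrightarrow> bergman_fun f z = 0"
    by eventually_elim (auto simp: indicator_def)
  show ?thesis
  proof (rule ccontr)
    assume nz: "bergman_fun f z \<noteq> 0"
    let ?U = "ball 0 1 \<inter> bergman_fun f -` (- {0})"
    have "open ?U"
      using holomorphic_on_imp_continuous_on[OF bergman_fun_holomorphic[of f]]
      by (intro continuous_open_preimage) auto
    moreover have "z \<in> ?U" using True nz by auto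
    ultimately have "?U \<notin> null_sets lborel"
      by (metis emptyE null_setsD1 open_not_negligible negligible_iff_null_sets null_sets_completionI)
    moreover have "?U \<in> sets lborel" using \<open>open ?U\<close> by simp
    moreover have "AE z in lborel. z \<notin> ?U" using ae by eventually_elim auto
    ultimately show False by (simp add: AE_iff_null_sets)
  qed
next
  case False
  then show ?thesis using bergman_fun[of f] by auto
qed

instantiation bergman :: complex_normed_vector
begin

lift_definition zero_bergman :: bergman is "\<lambda>_. 0"
  by (auto simp: set_integrable_def)

lift_definition plus_bergman :: "bergman \<Rightarrow> bergman \<Rightarrow> bergman" is "\<lambda>f g z. f z + g z"
  by (auto intro!: holomorphic_intros)

lift_definition minus_bergman :: "bergman \<Rightarrow> bergman \<Rightarrow> bergman" is "\<lambda>f g z. f z - g z"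
  by (auto intro!: holomorphic_intros)

lift_definition uminus_bergman :: "bergman \<Rightarrow> bergman" is "\<lambda>f z. - f z"
  by (auto intro!: holomorphic_intros simp: set_integrable_def)

lift_definition scaleR_bergman :: "real \<Rightarrow> bergman \<Rightarrow> bergman" is "\<lambda>r f z. complex_of_real r * f z"
  by (auto intro!: holomorphic_intros)

lift_definition scaleC_bergman :: "complex \<Rightarrow> bergman \<Rightarrow> bergman" is "\<lambda>a f z. a * f z"
  by (auto intro!: holomorphic_intros)

definition norm_bergman :: "bergman \<Rightarrow> real" where
  "norm_bergman f = (LINT z:ball 0 1|lborel. cmod (bergman_fun f z)) / pi"

definition sgn_bergman :: "bergman \<Rightarrow> bergman" where
  "sgn_bergman f = inverse (norm f) *\<^sub>R f"

definition dist_bergman :: "bergman \<Rightarrow> bergman \<Rightarrow> real" where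
  "dist_bergman f g = norm (f - g)"

definition uniformity_bergman :: "(bergman \<times> bergman) filter" where
  "uniformity_bergman = (INF e\<in>{0<..}. principal {(f, g). dist f g < e})"

definition open_bergman :: "bergman set \<Rightarrow> bool" where
  "open_bergman U \<longleftrightarrow> (\<forall>f\<in>U. \<forall>\<^sub>F (f', g) in uniformity. f' = f \<longrightarrow> g \<in> U)"

instance
proof
  fix f g h :: bergman and r s :: real and a b :: complex
  show "f + g + h = f + (g + h)" "f + g = g + f" "0 + f = f" "- f + f = 0" "f - g = f + - g"
    by (transfer; auto simp: add_ac)+
  show "r *\<^sub>R (f + g) = r *\<^sub>R f + r *\<^sub>R g" "(r + s) *\<^sub>R f = r *\<^sub>R f + s *\<^sub>R f"
    "r *\<^sub>R s *\<^sub>R f = (r * s) *\<^sub>R f" "1 *\<^sub>R f = f"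
    by (transfer; auto simp: algebra_simps)+
  show "a *\<^sub>C (f + g) = a *\<^sub>C f + a *\<^sub>C g" "(a + b) *\<^sub>C f = a *\<^sub>C f + b *\<^sub>C f"
    "a *\<^sub>C b *\<^sub>C f = (a * b) *\<^sub>C f" "complex_of_real r *\<^sub>C f = r *\<^sub>R f"
    by (transfer; auto simp: algebra_simps)+
  show "dist f g = norm (f - g)" by (rule dist_bergman_def)
  show "sgn f = inverse (norm f) *\<^sub>R f" by (rule sgn_bergman_def)
  show "uniformity = (INF e\<in>{0<..}. principal {(f, g :: bergman). dist f g < e})"
    by (rule uniformity_bergman_def)
  show "open U \<longleftrightarrow> (\<forall>f\<in>U. \<forall>\<^sub>F (f', g) in uniformity. f' = f \<longrightarrow> g \<in> U)" for U :: "bergman set"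
    by (rule open_bergman_def)
  show normC: "norm (a *\<^sub>C f) = cmod a * norm f" for a
    by (simp add: norm_bergman_def scaleC_bergman.rep_eq norm_mult)
  have "r *\<^sub>R f = complex_of_real r *\<^sub>C f" by transfer auto
  then show "norm (r *\<^sub>R f) = \<bar>r\<bar> * norm f" by (simp add: normC)
  show "norm f = 0 \<longleftrightarrow> f = 0"
  proof
    assume "norm f = 0"
    then have "bergman_fun f = bergman_fun 0"
      by (auto simp: norm_bergman_def zero_bergman.rep_eq dest: bergman_integral_eq_0D)
    then show "f = 0" by (simp add: bergman_fun_inject)
  qed (simp add: norm_bergman_def zero_bergman.rep_eq)
  have "(LINT z:ball 0 1|lborel. cmod (bergman_fun (f + g) z)) \<le>
        (LINT z:ball 0 1|lborel. cmod (bergman_fun f z) + cmod (bergman_fun g z))"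
    by (intro set_integral_mono set_integral_add bergman_fun_integrable_norm)
       (auto simp: plus_bergman.rep_eq norm_triangle_ineq)
  then show "norm (f + g) \<le> norm f + norm g"
    by (simp add: norm_bergman_def bergman_fun_integrable_norm divide_right_mono
        flip: add_divide_distrib)
qed

end

text \<open>
  \<open>z\<^sup>2 / ((1 - z)\<^sup>2 log\<^sup>2 (1 - z))\<close> has a holomorphic extension across \<open>0\<close> that lies in
  \<open>A\<^sup>1\<close>, so a normalizing constant exists. The equation is only required off \<open>0\<close> because
  HOL's totalized division would give the wrong value there; by continuity it determines the
  element of \<open>bergman\<close> completely.
\<close>

lemma ex_bergman_extremal:
  "\<exists>f. \<forall>z\<in>ball 0 1. z \<noteq> 0 \<longrightarrow> bergman_fun f z = z\<^sup>2 / ((1 - z)\<^sup>2 * (Ln (1 - z))\<^sup>2)"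
proof -
  define S :: "complex set" where "S = {z. 1 - z \<notin> \<real>\<^sub>\<le>\<^sub>0}"
  have S_eq: "S = (\<lambda>z. 1 - z) -` (- \<real>\<^sub>\<le>\<^sub>0)" by (auto simp: S_def)
  have opS: "open S" unfolding S_eq
    by (intro open_vimage continuous_intros) auto
  define h where "h z = (if z = 0 then deriv (\<lambda>z. Ln (1 - z)) 0
      else (Ln (1 - z) - Ln (1 - 0)) / (z - 0))" for z :: complex
  have "(\<lambda>z. Ln (1 - z)) holomorphic_on S"
    by (auto intro!: holomorphic_intros simp: S_def)
  then have hol_h: "h holomorphic_on S"
    unfolding h_def using opS by (rule pole_lemma_open)
  have "((\<lambda>z. Ln (1 - z)) has_field_derivative -1) (at 0)"
    by (auto intro!: derivative_eq_intros)
  then have h0: "h 0 = -1" by (simp add: h_def DERIV_imp_deriv)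
  have hz: "h z = Ln (1 - z) / z" if "z \<noteq> 0" for z
    using that by (simp add: h_def)
  have S1: "z \<noteq> 1" if "z \<in> S" for z using that by (auto simp: S_def)
  have nz: "h z \<noteq> 0" if "z \<in> S" for z
  proof (cases "z = 0")
    case False
    have "Ln (1 - z) \<noteq> 0"
    proof
      assume "Ln (1 - z) = 0"
      then have "exp (Ln (1 - z)) = 1" by simp
      moreover have "exp (Ln (1 - z)) = 1 - z" using S1[OF that] by (intro exp_Ln) auto
      ultimately show False using False by simp
    qed
    then show ?thesis using False by (simp add: hz)
  qed (simp add: h0)
  define g where "g z = 1 / ((1 - z)\<^sup>2 * (h z)\<^sup>2)" for z
  have hol_g: "g holomorphic_on S"
    unfolding g_def using nz S1 by (auto intro!: holomorphic_intros hol_h)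
  have gz: "g z = z\<^sup>2 / ((1 - z)\<^sup>2 * (Ln (1 - z))\<^sup>2)" if "z \<noteq> 0" for z
    using that by (simp add: g_def hz power_divide)
  have inS: "z \<in> S" if "cmod z \<le> 1" "z \<noteq> 1" for z
  proof -
    have "Re (1 - z) > 0"
    proof (rule ccontr)
      assume "\<not> ?thesis"
      then have "Re z \<ge> 1" by simp
      moreover have "(Re z)\<^sup>2 + (Im z)\<^sup>2 \<le> 1"
        using that(1) by (simp add: cmod_power2[symmetric] power_le_one)
      moreover have "(Re z)\<^sup>2 \<ge> 1" using \<open>Re z \<ge> 1\<close> by simp
      ultimately have "(Re z)\<^sup>2 = 1" "(Im z)\<^sup>2 = 0"
        using zero_le_power2[of "Im z"] by linarith+
      then have "Re z = 1" "Im z = 0" using \<open>Re z \<ge> 1\<close> by (auto simp: power2_eq_1_iff)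
      then show False using that(2) by (simp add: complex_eq_iff)
    qed
    then show ?thesis by (auto simp: S_def complex_nonpos_Reals_iff)
  qed
  have ball_S: "ball 0 1 \<subseteq> S"
  proof
    fix z :: complex assume "z \<in> ball 0 1"
    then show "z \<in> S" by (intro inS) auto
  qed
  define K where "K = cball (0::complex) 1 - ball 1 (1/2)"
  have "compact K" unfolding K_def by (intro compact_diff) auto
  moreover have "K \<subseteq> S"
  proof
    fix z assume "z \<in> K"
    then show "z \<in> S" by (intro inS) (auto simp: K_def)
  qed
  then have "continuous_on K g"
    using hol_g holomorphic_on_imp_continuous_on continuous_on_subset by blast
  ultimately have "bounded (g ` K)"
    by (intro compact_imp_bounded compact_continuous_image)
  then obtain B where B: "\<And>z. z \<in> K \<Longrightarrow> cmod (g z) \<le> B" and "B > 0"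
    by (auto simp: bounded_pos)
  define c where "c k = 4 ^ Suc (Suc k) / (real (Suc k) * ln 2)\<^sup>2" for k
  have near: "\<exists>k. cmod (1 - z) < (1/2) ^ Suc k \<and> cmod (g z) \<le> c k"
    if z: "z \<in> ball 0 1" "z \<notin> K" for z
  proof -
    define r where "r = cmod (1 - z)"
    have r: "0 < r" "r < 1/2" using z by (auto simp: r_def K_def dist_norm)
    have "\<exists>n. (1/2::real) ^ n < r" using r by (intro real_arch_pow_inv) auto
    then have ex: "\<exists>n. (1/2::real) ^ n \<le> r" by (auto intro: less_imp_le)
    define n where "n = (LEAST n. (1/2::real) ^ n \<le> r)"
    have n: "(1/2) ^ n \<le> r" unfolding n_def using ex by (rule LeastI_ex)
    have "n \<noteq> 0" using n r by (intro notI) simp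
    moreover have "n \<noteq> 1" using n r by (intro notI) simp
    ultimately obtain k where k: "n = Suc (Suc k)" by (metis One_nat_def not0_implies_Suc)
    have "\<not> (1/2) ^ Suc k \<le> r"
      using not_less_Least[of "Suc k" "\<lambda>n. (1/2::real) ^ n \<le> r"] k by (simp add: n_def)
    then have rk: "r < (1/2) ^ Suc k" by simp
    have z0: "z \<noteq> 0" using r by (auto simp: r_def)
    have "ln r \<le> ln ((1/2) ^ Suc k)" using rk r by (subst ln_le_cancel_iff) auto
    also have "\<dots> = - (real (Suc k) * ln 2)"
      by (simp add: ln_realpow ln_div del: power_Suc)
    finally have lnr: "ln r \<le> - (real (Suc k) * ln 2)" .
    have "real (Suc k) * ln 2 \<le> \<bar>Re (Ln (1 - z))\<bar>"
      using lnr r by (subst Re_Ln) (auto simp: r_def)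
    also have "\<dots> \<le> cmod (Ln (1 - z))" by (rule abs_Re_le_cmod)
    finally have L: "real (Suc k) * ln 2 \<le> cmod (Ln (1 - z))" .
    have "cmod (g z) = (cmod z)\<^sup>2 / (r\<^sup>2 * (cmod (Ln (1 - z)))\<^sup>2)"
      using z0 by (simp add: gz norm_divide norm_mult norm_power r_def)
    also have "\<dots> \<le> 1 / (((1/2) ^ n)\<^sup>2 * (real (Suc k) * ln 2)\<^sup>2)"
      using z n L by (intro frac_le mult_mono power_mono mult_pos_pos) (auto simp: power_le_one)
    also have "((1/2::real) ^ n)\<^sup>2 = 1 / 4 ^ n"
      by (simp add: power2_eq_square power_mult_distrib[symmetric] power_one_over)
    also have "1 / (1 / 4 ^ n * (real (Suc k) * ln 2)\<^sup>2) = c k"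
      by (simp add: c_def k del: power_Suc of_nat_Suc)
    finally show ?thesis using rk by (auto simp: r_def)
  qed
  have c_nonneg: "c k \<ge> 0" for k by (simp add: c_def)
  have meas: "(\<lambda>z. indicator (ball 0 1) z *\<^sub>R g z) \<in> borel_measurable borel"
    using hol_g ball_S
    by (intro borel_measurable_continuous_on_indicator holomorphic_on_imp_continuous_on)
       (auto intro: holomorphic_on_subset)
  let ?V = "unit_ball_vol (real DIM(complex))"
  have V: "?V \<ge> 0" by simp
  have "(\<integral>\<^sup>+z. norm (indicator (ball 0 1) z *\<^sub>R g z) \<partial>lborel) \<le>
      (\<integral>\<^sup>+z. ennreal B * indicator (ball (0::complex) 1) z +
        (\<Sum>k. ennreal (c k) * indicator (ball 1 ((1/2) ^ Suc k)) z) \<partial>lborel)"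
  proof (rule nn_integral_mono)
    fix z :: complex
    let ?t = "\<lambda>k. ennreal (c k) * indicator (ball 1 ((1/2) ^ Suc k)) z"
    show "ennreal (norm (indicator (ball 0 1) z *\<^sub>R g z)) \<le> ennreal B * indicator (ball 0 1) z + suminf ?t"
    proof (cases "z \<in> ball 0 1")
      case True
      show ?thesis
      proof (cases "z \<in> K")
        case True
        then have "ennreal (cmod (g z)) \<le> ennreal B" using B by (intro ennreal_leI) auto
        then show ?thesis using \<open>z \<in> ball 0 1\<close> by (auto intro: add_increasing2)
      next
        case False
        then obtain k where k: "cmod (1 - z) < (1/2) ^ Suc k" "cmod (g z) \<le> c k"
          using near \<open>z \<in> ball 0 1\<close> by blast
        have "ennreal (cmod (g z)) \<le> ?t k"
          using k by (auto simp: dist_norm intro: ennreal_leI)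
        also have "\<dots> \<le> suminf ?t"
        proof -
          have "sum ?t {k} \<le> suminf ?t" by (rule sum_le_suminf) auto
          then show ?thesis
            by (simp only: sum.insert[OF finite.emptyI] sum.empty empty_iff not_False_eq_True add_0_right)
        qed
        finally show ?thesis using \<open>z \<in> ball 0 1\<close> by (auto intro: add_increasing)
      qed
    qed simp
  qed
  also have "\<dots> = ennreal B * emeasure lborel (ball (0::complex) 1) +
      (\<Sum>k. ennreal (c k) * emeasure lborel (ball (1::complex) ((1/2) ^ Suc k)))"
  proof -
    have [measurable]: "ball w s \<in> sets borel" for w :: complex and s by simp
    have m: "(\<lambda>z. ennreal a * indicator (ball w s) z) \<in> borel_measurable lborel" for a s and w :: complex
      by measurable
    have e: "(\<integral>\<^sup>+z. ennreal a * indicator (ball w s) z \<partial>lborel) = ennreal a * emeasure lborel (ball w s)"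
      for a s and w :: complex
      by (rule nn_integral_cmult_indicator) simp
    show ?thesis
      by (subst nn_integral_add)
         (auto simp only: m e nn_integral_suminf intro!: borel_measurable_suminf_order m)
  qed
  also have "(\<lambda>k. ennreal (c k) * emeasure lborel (ball (1::complex) ((1/2) ^ Suc k))) =
      (\<lambda>k. ennreal (4 * ?V / (ln 2)\<^sup>2 * inverse ((real (Suc k))\<^sup>2)))"
  proof
    fix k
    have "c k * (?V * ((1/2) ^ Suc k) ^ 2) = 4 * ?V / (ln 2)\<^sup>2 * inverse ((real (Suc k))\<^sup>2)"
    proof -
      have "(((1/2::real)) ^ Suc k) ^ 2 = 1 / 4 ^ Suc k"
        by (simp add: power2_eq_square power_mult_distrib[symmetric] power_one_over)
      then show ?thesis
        by (simp add: c_def power_mult_distrib field_simps del: of_nat_Suc)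
    qed
    then show "ennreal (c k) * emeasure lborel (ball (1::complex) ((1/2) ^ Suc k)) =
        ennreal (4 * ?V / (ln 2)\<^sup>2 * inverse ((real (Suc k))\<^sup>2))"
      using c_nonneg[of k] by (simp add: emeasure_ball ennreal_mult[symmetric] del: power_Suc of_nat_Suc)
  qed
  also have "(ennreal B * emeasure lborel (ball (0::complex) 1) +
      (\<Sum>k. ennreal (4 * ?V / (ln 2)\<^sup>2 * inverse ((real (Suc k))\<^sup>2)))) < \<infinity>"
  proof -
    have "summable (\<lambda>k. inverse ((real (Suc k))\<^sup>2))"
      using inverse_power_summable[of 2, where 'a = real] by (subst summable_Suc_iff) simp
    then have "summable (\<lambda>k. 4 * ?V / (ln 2)\<^sup>2 * inverse ((real (Suc k))\<^sup>2))"
      by (rule summable_mult)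
    then have "(\<Sum>k. ennreal (4 * ?V / (ln 2)\<^sup>2 * inverse ((real (Suc k))\<^sup>2))) \<noteq> top"
      using V by (subst suminf_ennreal2) auto
    then show ?thesis
      by (auto simp: emeasure_ball ennreal_mult_less_top less_top)
  qed
  finally have "integrable lborel (\<lambda>z. indicator (ball 0 1) z *\<^sub>R g z)"
    using meas by (intro integrableI_bounded) auto
  then have int: "set_integrable lborel (ball 0 1) g" by (simp add: set_integrable_def)
  define G where "G z = (if z \<in> ball 0 1 then g z else 0)" for z
  have "G holomorphic_on ball 0 1"
    using hol_g ball_S by (subst holomorphic_cong[OF refl, of _ _ g])
      (auto simp: G_def intro: holomorphic_on_subset)
  moreover have "set_integrable lborel (ball 0 1) G"
    using int set_integrable_cong[of lborel lborel "ball 0 1" "ball 0 1" G g] by (simp add: G_def)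
  ultimately have "bergman_fun (Abs_bergman G) = G"
    by (intro Abs_bergman_inverse) (auto simp: G_def)
  then show ?thesis by (intro exI[of _ "Abs_bergman G"]) (auto simp: G_def gz)
qed

lemma ex_bergman_extremal_normalized:
  "\<exists>c > 0. \<exists>f. norm f = 1 \<and> (\<forall>z\<in>ball 0 1. z \<noteq> 0 \<longrightarrow>
     bergman_fun f z = complex_of_real c * z\<^sup>2 / ((1 - z)\<^sup>2 * (Ln (1 - z))\<^sup>2))"
proof -
  obtain f where f: "\<And>z. z \<in> ball 0 1 \<Longrightarrow> z \<noteq> 0 \<Longrightarrow>
      bergman_fun f z = z\<^sup>2 / ((1 - z)\<^sup>2 * (Ln (1 - z))\<^sup>2)"
    using ex_bergman_extremal by blast
  have "Ln (1/2) \<noteq> (0::complex)"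
    by (metis exp_Ln exp_zero divide_eq_1_iff one_neq_zero zero_neq_numeral numeral_One numeral_eq_iff num.distinct(1) divide_eq_0_iff)
  then have "bergman_fun f (1/2) \<noteq> 0"
    by (subst f) (auto simp: norm_divide)
  then have "f \<noteq> 0" by (auto simp: zero_bergman.rep_eq)
  then show ?thesis
    by (intro exI[of _ "inverse (norm f)"] conjI exI[of _ "inverse (norm f) *\<^sub>R f"])
       (auto simp: scaleR_bergman.rep_eq f)
qed

end

theory Submission
  imports Defs
begin

text \<open>
  Write \<open>w = log (1 - z)\<close> and \<open>u\<^sub>\<epsilon> = f w\<^sup>2 / (1 + \<epsilon> w\<^sup>2)\<close>. As \<open>w\<close> takes values in a horizontal
  strip, the factor \<open>w\<^sup>2 / (1 + \<epsilon> w\<^sup>2)\<close> is bounded for each \<open>\<epsilon>\<close> and differs from its modulus by an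
  amount bounded independently of \<open>\<epsilon>\<close>. Hence for every support functional \<open>L\<close> at \<open>f\<close>, \<open>Re L(u\<^sub>\<epsilon>)\<close>
  differs from \<open>\<parallel>u\<^sub>\<epsilon>\<parallel>\<close> by a bounded amount. As \<open>\<epsilon> \<rightarrow> 0\<close> the norms \<open>\<parallel>u\<^sub>\<epsilon>\<parallel>\<close> tend to infinity,
  because \<open>u\<^sub>\<epsilon>\<close> tends to the non-integrable function \<open>c z\<^sup>2 / (1 - z)\<^sup>2\<close>, so
  \<open>L(u\<^sub>\<epsilon> / \<parallel>u\<^sub>\<epsilon>\<parallel>) \<rightarrow> 1\<close>. But \<open>(1 - z)\<^sup>2 u\<^sub>\<epsilon>\<close> stays bounded, so the normalized functions
  concentrate at \<open>1\<close> and cannot converge to \<open>f\<close>.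
\<close>

section \<open>Multiplication operators on the Bergman space\<close>

definition bergman_mult :: "(complex \<Rightarrow> complex) \<Rightarrow> bergman \<Rightarrow> bergman" where
  "bergman_mult q f = Abs_bergman (\<lambda>z. q z * bergman_fun f z)"

lemma bergman_fun_outside: "z \<notin> ball 0 1 \<Longrightarrow> bergman_fun f z = 0"
  using bergman_fun[of f] by auto

text \<open>\<open>Abs_bergman\<close> can be unfolded only once the product is known to lie in the
  space: it is dominated by \<open>Q\<close> times the modulus of \<open>f\<close>, and it vanishes
  off the disc because \<open>f\<close> does.\<close>

lemma bergman_fun_mult:
  assumes hol: "q holomorphic_on ball 0 1" and Q: "\<And>z. z \<in> ball 0 1 \<Longrightarrow> cmod (q z) \<le> Q"
  shows "bergman_fun (bergman_mult q f) = (\<lambda>z. q z * bergman_fun f z)"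
proof -
  have hol': "(\<lambda>z. q z * bergman_fun f z) holomorphic_on ball 0 1"
    by (intro holomorphic_intros hol bergman_fun_holomorphic)
  have "set_integrable lborel (ball 0 1) (\<lambda>z. Q * cmod (bergman_fun f z))"
    using bergman_fun_integrable_norm by simp
  moreover have "set_borel_measurable lborel (ball 0 1) (\<lambda>z. q z * bergman_fun f z)"
    unfolding set_borel_measurable_def measurable_lborel2
    by (intro borel_measurable_continuous_on_indicator holomorphic_on_imp_continuous_on hol') auto
  ultimately have "set_integrable lborel (ball 0 1) (\<lambda>z. q z * bergman_fun f z)"
    unfolding set_integrable_def set_borel_measurable_def
    by (rule Bochner_Integration.integrable_bound)
       (auto simp: indicator_def norm_mult abs_mult intro!: mult_right_mono order_trans[OF Q])
  then show ?thesis
    unfolding bergman_mult_def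
    by (intro Abs_bergman_inverse) (use hol' in \<open>auto simp: bergman_fun_outside\<close>)
qed

lemma bergman_norm_mono:
  assumes "\<And>z. z \<in> ball 0 1 \<Longrightarrow> cmod (bergman_fun f z) \<le> cmod (bergman_fun g z)"
  shows "norm f \<le> norm g"
  unfolding norm_bergman_def
  by (intro divide_right_mono set_integral_mono bergman_fun_integrable_norm assms) auto

lemma measure_unit_disc: "measure lborel (ball (0::complex) 1) = pi"
  by (simp add: content_ball unit_ball_vol_2)

lemma set_integrable_const_disc: "set_integrable lborel (ball (0::complex) 1) (\<lambda>_. B::real)"
  unfolding set_integrable_def by (auto simp: emeasure_ball)

lemma bergman_norm_le_bound:
  assumes "\<And>z. z \<in> ball 0 1 \<Longrightarrow> cmod (bergman_fun f z) \<le> B"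
  shows "norm f \<le> B"
proof -
  have "(LINT z:ball 0 1|lborel. cmod (bergman_fun f z)) \<le> (LINT z:ball (0::complex) 1|lborel. B)"
    by (intro set_integral_mono bergman_fun_integrable_norm set_integrable_const_disc assms)
  also have "\<dots> = pi * B"
    unfolding set_lebesgue_integral_def by (simp add: measure_unit_disc)
  finally show ?thesis unfolding norm_bergman_def by (simp add: field_simps)
qed

lemma bergman_norm_mult_le:
  assumes hol: "q holomorphic_on ball 0 1" and Q: "\<And>z. z \<in> ball 0 1 \<Longrightarrow> cmod (q z) \<le> Q"
  shows "norm (bergman_mult q f) \<le> Q * norm f"
proof -
  have "Q \<ge> 0" using Q[of 0] norm_ge_zero[of "q 0"] by (simp del: norm_ge_zero)
  have "bergman_fun (bergman_mult q f) = (\<lambda>z. q z * bergman_fun f z)"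
    by (rule bergman_fun_mult[OF assms])
  then have "norm (bergman_mult q f) \<le> norm (Q *\<^sub>R f)"
    using \<open>Q \<ge> 0\<close>
    by (intro bergman_norm_mono)
       (auto simp: scaleR_bergman.rep_eq norm_mult intro!: mult_right_mono Q)
  then show ?thesis using \<open>Q \<ge> 0\<close> by simp
qed

section \<open>Support functionals and normalized sequences\<close>

lemma norm_one_minus_le: "cmod (1 - x) \<le> 1 - Re x + (cmod x)\<^sup>2 / 2"
proof -
  have "(cmod (1 - x))\<^sup>2 = 1 - 2 * Re x + (cmod x)\<^sup>2"
    unfolding cmod_power2 by (simp add: power2_eq_square algebra_simps)
  \<comment> \<open>AM-GM replaces the square root by its tangent at 1, so the first-order term
    \<open>- Re x\<close> stays exact.\<close>
  moreover have "2 * cmod (1 - x) \<le> (cmod (1 - x))\<^sup>2 + 1"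
    using sum_squares_bound[of "cmod (1 - x)" 1] by simp
  ultimately show ?thesis by simp
qed

text \<open>
  A support functional at \<open>f\<close> must satisfy \<open>L(h) = \<integral> h \<cdot> cnj f / |f| dA\<close>. The half of this
  that is needed, for \<open>h = f q\<close>, comes from comparing \<open>Re L(f - t f q)\<close> with \<open>\<parallel>f - t f q\<parallel>\<close>
  as \<open>t \<rightarrow> 0+\<close>, without a representation theorem for \<open>L\<close>.
\<close>

lemma support_functional_mult_ge:
  assumes L: "bounded_linear L" "onorm L = 1" "L f = (1::complex)" and f: "norm f = 1"
    and hol: "q holomorphic_on ball 0 1" and Q: "\<And>z. z \<in> ball 0 1 \<Longrightarrow> cmod (q z) \<le> Q"
    and D: "\<And>z. z \<in> ball 0 1 \<Longrightarrow> cmod (q z) - Re (q z) \<le> D"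
  shows "Re (L (bergman_mult q f)) \<ge> norm (bergman_mult q f) - D"
proof -
  define u where "u = bergman_mult q f"
  interpret L: bounded_linear L by fact
  have Lle: "cmod (L h) \<le> norm h" for h
    using onorm[OF L(1), of h] L(2) by simp
  have uf: "bergman_fun u = (\<lambda>z. q z * bergman_fun f z)"
    unfolding u_def by (rule bergman_fun_mult[OF hol Q])
  have ineq: "norm u - D \<le> Re (L u) + t * Q\<^sup>2 / 2" if "t > 0" for t :: real
  proof -
    let ?F = "\<lambda>z. cmod (bergman_fun f z)" and ?U = "\<lambda>z. cmod (bergman_fun u z)"
    note int = bergman_fun_integrable_norm
    have "pi * norm (f - t *\<^sub>R u) = (LINT z:ball 0 1|lborel. cmod (bergman_fun (f - t *\<^sub>R u) z))"
      by (simp add: norm_bergman_def)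
    also have "\<dots> \<le> (LINT z:ball 0 1|lborel. (1 + t * D + t\<^sup>2 * Q\<^sup>2 / 2) * ?F z - t * ?U z)"
    proof (intro set_integral_mono int set_integral_diff set_integrable_mult_right)
      fix z :: complex assume z: "z \<in> ball 0 1"
      have "cmod (bergman_fun (f - t *\<^sub>R u) z) = cmod (1 - t *\<^sub>R q z) * ?F z"
        by (simp add: minus_bergman.rep_eq scaleR_bergman.rep_eq uf norm_mult[symmetric] algebra_simps
            scaleR_conv_of_real)
      also have "\<dots> \<le> (1 - t * Re (q z) + t\<^sup>2 * (cmod (q z))\<^sup>2 / 2) * ?F z"
        using norm_one_minus_le[of "t *\<^sub>R q z"] by (intro mult_right_mono) (auto simp: power_mult_distrib)
      \<comment> \<open>Trading \<open>Re (q z)\<close> for \<open>cmod (q z) - D\<close> makes the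
        first-order term integrate to \<open>norm u\<close>.\<close>
      also have "\<dots> \<le> (1 + t * (D - cmod (q z)) + t\<^sup>2 * Q\<^sup>2 / 2) * ?F z"
      proof -
        have "t * (cmod (q z) - Re (q z)) \<le> t * D" using D[OF z] that by (intro mult_left_mono) auto
        moreover have "t\<^sup>2 * (cmod (q z))\<^sup>2 \<le> t\<^sup>2 * Q\<^sup>2"
          using Q[OF z] by (intro mult_left_mono power_mono) auto
        ultimately show ?thesis by (intro mult_right_mono) (auto simp: algebra_simps)
      qed
      finally show "cmod (bergman_fun (f - t *\<^sub>R u) z) \<le> (1 + t * D + t\<^sup>2 * Q\<^sup>2 / 2) * ?F z - t * ?U z"
        by (simp add: uf norm_mult algebra_simps)
    qed
    also have "\<dots> = pi * ((1 + t * D + t\<^sup>2 * Q\<^sup>2 / 2) * norm f - t * norm u)"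
      using int[of f] int[of u] by (simp add: norm_bergman_def algebra_simps)
    finally have "norm (f - t *\<^sub>R u) \<le> 1 + t * D + t\<^sup>2 * Q\<^sup>2 / 2 - t * norm u"
      using f by simp
    moreover have "Re (L (f - t *\<^sub>R u)) \<le> norm (f - t *\<^sub>R u)"
      using complex_Re_le_cmod Lle order_trans by blast
    \<comment> \<open>\<open>L f = 1\<close> cancels against \<open>norm f = 1\<close>, so
      \<open>t\<close> divides out and the error is only \<open>t * Q\<^sup>2 / 2\<close>.\<close>
    ultimately have "t * (norm u - D) \<le> t * (Re (L u) + t * Q\<^sup>2 / 2)"
      by (simp add: L.diff L.scaleR L(3) algebra_simps power2_eq_square)
    then show ?thesis using that by simp
  qed
  have "((\<lambda>t. Re (L u) + t * Q\<^sup>2 / 2) \<longlongrightarrow> Re (L u) + 0 * Q\<^sup>2 / 2) (at_right 0)"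
    by (intro tendsto_intros) simp
  then have "norm u - D \<le> Re (L u) + 0 * Q\<^sup>2 / 2"
    by (rule tendsto_lowerbound) (use eventually_mono[OF eventually_at_right_less ineq] in auto)
  then show ?thesis by (simp add: u_def)
qed

text \<open>As \<open>D\<close> does not depend on \<open>n\<close>, dividing by
  \<open>norm (u n)\<close> gives values of \<open>L\<close> with real part at least
  \<open>1 - D / norm (u n)\<close>; being of modulus at most 1, they tend to 1.\<close>

lemma not_strongly_exposedI:
  fixes f :: "'a::complex_normed_vector"
  assumes lower: "\<And>L n. bounded_linear L \<Longrightarrow> onorm L = 1 \<Longrightarrow> L f = (1::complex) \<Longrightarrow>
      Re (L (u n)) \<ge> norm (u n) - D"
    and lim: "filterlim (\<lambda>n. norm (u n)) at_top sequentially"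
    and away: "\<not> (\<lambda>n. norm (u n /\<^sub>R norm (u n) - f)) \<longlonglongrightarrow> 0"
  shows "\<not> strongly_exposed f"
proof
  assume "strongly_exposed f"
  then obtain L where L: "bounded_linear L" "onorm L = 1" "L f = (1::complex)"
    and seq: "\<And>v :: nat \<Rightarrow> 'a. (\<forall>n. norm (v n) \<le> 1) \<Longrightarrow> (\<lambda>n. L (v n)) \<longlonglongrightarrow> 1 \<Longrightarrow>
          (\<lambda>n. norm (v n - f)) \<longlonglongrightarrow> 0"
    unfolding strongly_exposed_def bounded_clinear_functional_def by blast
  interpret L: bounded_linear L by fact
  define v where "v n = u n /\<^sub>R norm (u n)" for n
  \<comment> \<open>Where \<open>u n = 0\<close>, the convention \<open>inverse 0 = 0\<close> makes
    \<open>v n = 0\<close>.\<close>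
  have nv: "norm (v n) \<le> 1" for n by (cases "u n = 0") (auto simp: v_def)
  have Lv: "cmod (L (v n)) \<le> 1" for n
    using onorm[OF L(1), of "v n"] L(2) nv[of n] by simp
  have inv0: "(\<lambda>n. 1 / norm (u n)) \<longlonglongrightarrow> 0"
    using tendsto_inverse_0_at_top[OF lim] by (simp add: divide_inverse)
  have ev: "\<forall>\<^sub>F n in sequentially. (cmod (L (v n) - 1))\<^sup>2 \<le> 2 * D * (1 / norm (u n))"
    using filterlim_at_top_dense[THEN iffD1, OF lim, rule_format, of 0]
  proof eventually_elim
    case (elim n)
    have "1 - D / norm (u n) \<le> Re (L (v n))"
      using divide_right_mono[OF lower[OF L, of n], of "norm (u n)"] elim
      by (simp add: v_def L.scaleR diff_divide_distrib inverse_eq_divide)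
    moreover have "(cmod (L (v n)))\<^sup>2 \<le> 1" using Lv[of n] by (simp add: power_le_one)
    moreover have "(cmod (L (v n) - 1))\<^sup>2 = 1 - 2 * Re (L (v n)) + (cmod (L (v n)))\<^sup>2"
      unfolding cmod_power2 by (simp add: power2_eq_square algebra_simps)
    ultimately have "(cmod (L (v n) - 1))\<^sup>2 \<le> 2 * (D / norm (u n))" by linarith
    then show ?case by simp
  qed
  have "(\<lambda>n. (cmod (L (v n) - 1))\<^sup>2) \<longlonglongrightarrow> 0"
    by (rule tendsto_sandwich[OF _ ev tendsto_const]) (use tendsto_mult_left[OF inv0, of "2 * D"] in auto)
  from tendsto_real_sqrt[OF this] have "(\<lambda>n. cmod (L (v n) - 1)) \<longlonglongrightarrow> 0" by simp
  then have "(\<lambda>n. L (v n)) \<longlonglongrightarrow> 1" using LIM_zero_iff tendsto_norm_zero_iff by blast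
  then show False using seq[of v] nv away by (simp add: v_def)
qed

section \<open>Logarithmic divergence near the boundary point 1\<close>

text \<open>
  The integral of \<open>1 / |1 - z|\<^sup>2\<close> over the disc diverges logarithmically: each of the
  disjoint discs below contributes the same amount.
\<close>

definition tangent_disc :: "nat \<Rightarrow> complex set" where
  "tangent_disc k = ball (1 - of_real (1 / 4 ^ k / 2)) (1 / 4 ^ k / 4)"

text \<open>With \<open>r = 1 / 4 ^ k\<close>, the point \<open>1 - z\<close> is within
  \<open>r / 4\<close> of \<open>r / 2\<close>, and the centre has modulus
  \<open>1 - r / 2\<close>.\<close>

lemma tangent_discD:
  assumes "z \<in> tangent_disc k"
  shows "1 / 4 ^ k / 4 < cmod (1 - z)" "cmod (1 - z) < 3 / 4 * (1 / 4 ^ k)"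
    and "cmod z \<ge> 1 / 4" "z \<in> ball 0 1"
proof -
  define r :: real where "r = 1 / 4 ^ k"
  have r: "0 < r" "r \<le> 1" by (auto simp: r_def)
  have *: "cmod ((1 - z) - of_real (r / 2)) < r / 4"
    using assms by (simp add: tangent_disc_def r_def dist_norm algebra_simps)
  have nr: "cmod (of_real (r / 2)) = r / 2" using r by simp
  show 1: "1 / 4 ^ k / 4 < cmod (1 - z)"
    using * norm_triangle_ineq3[of "1 - z" "of_real (r / 2)"] nr unfolding r_def[symmetric] by linarith
  show 2: "cmod (1 - z) < 3 / 4 * (1 / 4 ^ k)"
    using * norm_triangle_ineq3[of "1 - z" "of_real (r / 2)"] nr unfolding r_def[symmetric] by linarith
  then show "cmod z \<ge> 1 / 4"
    using norm_triangle_ineq2[of 1 "1 - z"] r unfolding r_def[symmetric] by simp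
  have "cmod z \<le> cmod (1 - of_real (r / 2)) + cmod ((1 - z) - of_real (r / 2))"
    using norm_triangle_ineq4[of "1 - of_real (r / 2)" "(1 - z) - of_real (r / 2)"] by simp
  moreover have "cmod (1 - of_real (r / 2)) = 1 - r / 2"
  proof -
    have "1 - complex_of_real (r / 2) = of_real (1 - r / 2)" by simp
    then have "cmod (1 - of_real (r / 2)) = \<bar>1 - r / 2\<bar>" by (simp only: norm_of_real)
    then show ?thesis using r by simp
  qed
  ultimately show "z \<in> ball 0 1" using * r by simp
qed

text \<open>The ranges of \<open>cmod (1 - z)\<close> do not overlap: their endpoints have ratio 3,
  while the scale shrinks by 4.\<close>

lemma tangent_disc_disjoint:
  assumes "z \<in> tangent_disc j" "z \<in> tangent_disc k"
  shows "j = k"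
proof (rule ccontr)
  assume "j \<noteq> k"
  have False if "i < l" "z \<in> tangent_disc i" "z \<in> tangent_disc l" for i l
  proof -
    have "(4::real) ^ Suc i \<le> 4 ^ l" using that by (intro power_increasing) auto
    moreover have "(0::real) \<le> 4 ^ i" by simp
    ultimately have "3 * (4::real) ^ i \<le> 4 ^ l" unfolding power_Suc by linarith
    then have "3 / 4 * ((1::real) / 4 ^ l) \<le> 1 / 4 ^ i / 4" by (simp add: field_simps)
    then show False using tangent_discD(1)[OF that(2)] tangent_discD(2)[OF that(3)] by linarith
  qed
  then show False using assms \<open>j \<noteq> k\<close> by (cases j k rule: linorder_cases) auto
qed

text \<open>On disc \<open>k\<close> the modulus of \<open>f\<close> is at least \<open>d k\<close>,
  and \<open>d k\<close> times the area is \<open>a * pi / 9\<close> for every \<open>k\<close>.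
  Disjointness keeps the sum of these step functions below the modulus of \<open>f\<close>.\<close>

lemma bergman_norm_ge_tangent_discs:
  assumes "a \<ge> 0"
    and ge: "\<And>k z. k < K \<Longrightarrow> z \<in> tangent_disc k \<Longrightarrow> cmod (bergman_fun f z) \<ge> a / (cmod (1 - z))\<^sup>2"
  shows "norm f \<ge> real K * (a / 9)"
proof -
  define d where "d k = a * 16 / 9 * 16 ^ k" for k :: nat
  have d0: "d k \<ge> 0" for k using assms by (simp add: d_def)
  have meas: "measure lborel (tangent_disc k) = pi / 16 / 16 ^ k" for k
  proof -
    have "(4::real) ^ k * 4 ^ k = 16 ^ k" by (simp add: power_mult_distrib[symmetric])
    then show ?thesis
      by (simp add: tangent_disc_def content_ball unit_ball_vol_2 power2_eq_square)
  qed
  have int: "integrable lborel (\<lambda>z. d k * indicator (tangent_disc k) z)" for k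
    by (auto simp: tangent_disc_def emeasure_ball)
  have "real K * (a / 9) * pi = (\<Sum>k<K. d k * measure lborel (tangent_disc k))"
    by (simp add: meas d_def)
  also have "\<dots> = (LINT z|lborel. (\<Sum>k<K. d k * indicator (tangent_disc k) z))"
    using int by (subst Bochner_Integration.integral_sum) (auto simp: tangent_disc_def)
  also have "\<dots> \<le> (LINT z:ball 0 1|lborel. cmod (bergman_fun f z))"
    unfolding set_lebesgue_integral_def
  proof (intro integral_mono Bochner_Integration.integrable_sum int)
    show "integrable lborel (\<lambda>z. indicator (ball 0 1) z *\<^sub>R cmod (bergman_fun f z))"
      using bergman_fun_integrable_norm[of f] by (simp add: set_integrable_def)
    fix z :: complex
    show "(\<Sum>k<K. d k * indicator (tangent_disc k) z) \<le> indicator (ball 0 1) z *\<^sub>R cmod (bergman_fun f z)"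
    proof (cases "\<exists>k<K. z \<in> tangent_disc k")
      case True
      then obtain k where k: "k < K" "z \<in> tangent_disc k" by blast
      have "(\<Sum>j<K. d j * indicator (tangent_disc j) z) = (\<Sum>j<K. if j = k then d k else 0)"
      proof (rule sum.cong[OF refl])
        fix j
        show "d j * indicator (tangent_disc j) z = (if j = k then d k else 0)"
          using k(2) tangent_disc_disjoint[OF _ k(2), of j] by (cases "j = k") (auto simp: indicator_def)
      qed
      also have "\<dots> = d k" using k by simp
      also have "\<dots> \<le> a / (cmod (1 - z))\<^sup>2"
      proof -
        have "(cmod (1 - z))\<^sup>2 \<le> (3 / 4 * (1 / 4 ^ k))\<^sup>2"
          using tangent_discD(2)[OF k(2)] by (intro power_mono) auto
        also have "\<dots> = 9 / 16 / 16 ^ k"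
        proof -
          have "(4::real) ^ k * 4 ^ k = 16 ^ k" by (simp add: power_mult_distrib[symmetric])
          then show ?thesis by (simp add: power2_eq_square)
        qed
        finally have le: "(cmod (1 - z))\<^sup>2 \<le> 9 / 16 / 16 ^ k" .
        have "1 / 4 ^ k / 4 < cmod (1 - z)" by (rule tangent_discD(1)[OF k(2)])
        then have "0 < cmod (1 - z)" by (rule le_less_trans[rotated]) auto
        then have "a / (9 / 16 / 16 ^ k) \<le> a / (cmod (1 - z))\<^sup>2"
          using assms(1) le by (intro divide_left_mono) auto
        then show ?thesis by (simp add: d_def)
      qed
      also have "\<dots> \<le> cmod (bergman_fun f z)" by (rule ge) fact+
      finally show ?thesis using tangent_discD(4)[OF k(2)] by simp
    next
      case False
      then have "(\<Sum>k<K. d k * indicator (tangent_disc k) z) = 0"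
        by (intro sum.neutral) auto
      then show ?thesis by simp
    qed
  qed
  finally show ?thesis by (simp add: norm_bergman_def field_simps)
qed

section \<open>The damped square on a strip\<close>

text \<open>\<open>n + 8\<close> makes \<open>\<epsilon> = 1 / (n + 8)\<close> small enough to keep the denominator away from \<open>0\<close> on the strip.\<close>

definition damped_square :: "nat \<Rightarrow> complex \<Rightarrow> complex" where
  "damped_square n w = w\<^sup>2 / (1 + w\<^sup>2 / of_nat (n + 8))"

lemma strip_bounds:
  assumes "\<bar>Im w\<bar> \<le> 2"
  shows "cmod (1 + w\<^sup>2 / of_nat (n + 8)) \<ge> 1 / 2"
    and "cmod (damped_square n w) \<le> 3 * real (n + 8)"
    and "cmod (damped_square n w) - Re (damped_square n w) \<le> 32"
proof -
  define e :: real where "e = 1 / real (n + 8)"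
  have e: "e > 0" "e \<le> 1 / 8" by (auto simp: e_def)
  define a b where "a = Re w" and "b = Im w"
  define P where "P = a\<^sup>2 + b\<^sup>2"
  define d where "d = 1 + e *\<^sub>R w\<^sup>2"
  have d_eq: "1 + w\<^sup>2 / of_nat (n + 8) = d"
    by (simp add: d_def e_def scaleR_conv_of_real)
  have b: "b\<^sup>2 \<le> 4" using assms abs_le_square_iff[of b 2] by (simp add: b_def)
  have Rew: "Re (w\<^sup>2) = a\<^sup>2 - b\<^sup>2" by (simp add: a_def b_def Re_power2)
  \<comment> \<open>Since \<open>e \<le> 1 / 8\<close>, this keeps \<open>Re d\<close> at or above
    \<open>1 - 4 * e \<ge> 1 / 2\<close>.\<close>
  have "e * (a\<^sup>2 - b\<^sup>2) \<ge> e * (-4)"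
    using e b zero_le_power2[of a] by (intro mult_left_mono) linarith+
  then have "Re d \<ge> 1 / 2" using e by (simp add: d_def Rew)
  then have nd: "cmod d \<ge> 1 / 2" using complex_Re_le_cmod[of d] by linarith
  then show "cmod (1 + w\<^sup>2 / of_nat (n + 8)) \<ge> 1 / 2" by (simp only: d_eq)
  have d0: "d \<noteq> 0" using nd by auto
  have q: "damped_square n w = w\<^sup>2 / d" by (simp add: damped_square_def flip: d_eq)
  have "w\<^sup>2 = (d - 1) / of_real e" using e by (simp add: d_def scaleR_conv_of_real)
  then have "w\<^sup>2 / d = (1 - 1 / d) / of_real e" using d0 by (simp add: diff_divide_distrib)
  moreover have "cmod (1 - 1 / d) \<le> 1 + 1 / cmod d"
    using norm_triangle_ineq4[of 1 "1 / d"] by (simp add: norm_divide)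
  moreover have "1 / cmod d \<le> 2" using nd frac_le[of 1 1 "1/2" "cmod d"] by simp
  ultimately have "cmod (w\<^sup>2 / d) \<le> 3 / e"
    using e by (simp add: norm_divide divide_right_mono)
  then show "cmod (damped_square n w) \<le> 3 * real (n + 8)" by (simp add: q e_def)
  have P: "cmod (w\<^sup>2) = P" by (simp add: P_def a_def b_def norm_power cmod_power2)
  have w4: "w\<^sup>2 * cnj (w\<^sup>2) = of_real (P\<^sup>2)" using P by (metis complex_norm_square of_real_power)
  have "w\<^sup>2 * cnj d = w\<^sup>2 + of_real (e * P\<^sup>2)"
    using w4 by (simp add: d_def algebra_simps scaleR_conv_of_real)
  then have Req: "Re (w\<^sup>2 * cnj d) = a\<^sup>2 - b\<^sup>2 + e * P\<^sup>2" by (simp only: plus_complex.simps Rew Re_complex_of_real)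
  have Rq: "Re (w\<^sup>2 / d) = (a\<^sup>2 - b\<^sup>2 + e * P\<^sup>2) / (cmod d)\<^sup>2"
    by (subst complex_div_cnj) (simp only: Req[symmetric] Re_divide_of_real flip: of_real_power)
  have "cmod d \<le> 1 + e * P" unfolding d_def using norm_triangle_ineq[of 1 "e *\<^sub>R w\<^sup>2"] e P by simp
  moreover have "P \<ge> 0" by (simp add: P_def)
  ultimately have "P * cmod d \<le> P + e * P\<^sup>2"
    using mult_left_mono[of "cmod d" "1 + e * P" P] by (simp add: algebra_simps power2_eq_square)
  \<comment> \<open>The \<open>e * P\<^sup>2\<close> terms cancel, leaving
    \<open>P - (a\<^sup>2 - b\<^sup>2) = 2 * b\<^sup>2\<close>, which the strip bounds independently
    of \<open>e\<close>.\<close>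
  then have "P * cmod d - (a\<^sup>2 - b\<^sup>2 + e * P\<^sup>2) \<le> 8" using b by (simp add: P_def)
  moreover have "cmod (w\<^sup>2 / d) = P * cmod d / (cmod d)\<^sup>2"
    using d0 P by (simp add: norm_divide power2_eq_square)
  ultimately have "cmod (w\<^sup>2 / d) - Re (w\<^sup>2 / d) \<le> 8 / (cmod d)\<^sup>2"
    unfolding Rq by (simp add: divide_right_mono flip: diff_divide_distrib)
  also have "\<dots> \<le> 8 / (1 / 2)\<^sup>2" using nd by (intro frac_le power_mono) auto
  finally show "cmod (damped_square n w) - Re (damped_square n w) \<le> 32"
    by (simp add: q power2_eq_square)
qed

section \<open>The logarithm on the disc\<close>

lemma Re_one_minus_disc: "z \<in> ball 0 1 \<Longrightarrow> Re (1 - z) > 0"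
  using complex_Re_le_cmod[of z] by simp

lemma one_minus_disc_nonpos: "z \<in> ball (0::complex) 1 \<Longrightarrow> 1 - z \<notin> \<real>\<^sub>\<le>\<^sub>0"
  using Re_one_minus_disc[of z] by (auto simp: complex_nonpos_Reals_iff)

text \<open>On the right half-plane the argument is below \<open>pi / 2\<close>; 2 is the half-width
  required by \<open>strip_bounds\<close>.\<close>

lemma Im_Ln_disc:
  assumes "z \<in> ball 0 1"
  shows "\<bar>Im (Ln (1 - z))\<bar> \<le> 2"
proof -
  have "1 - z \<noteq> 0" using assms by auto
  then have "\<bar>Im (Ln (1 - z))\<bar> < pi / 2"
    using Re_Ln_pos_lt Re_one_minus_disc[OF assms] by blast
  then show ?thesis using pi_less_4 by linarith
qed

lemma Ln_disc_nonzero: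
  assumes "z \<in> ball 0 1" "z \<noteq> 0"
  shows "Ln (1 - z) \<noteq> 0"
proof
  have "1 - z \<noteq> 0" using assms by auto
  moreover assume "Ln (1 - z) = 0"
  ultimately show False using exp_Ln[of "1 - z"] assms by simp
qed

lemma damped_square_Ln_holomorphic:
  "(\<lambda>z. damped_square n (Ln (1 - z))) holomorphic_on ball 0 1"
proof -
  have "1 + (Ln (1 - z))\<^sup>2 / of_nat (n + 8) \<noteq> 0" if "z \<in> ball 0 1" for z
    using strip_bounds(1)[OF Im_Ln_disc[OF that], of n] by auto
  then show ?thesis
    unfolding damped_square_def
    by (intro holomorphic_intros) (use one_minus_disc_nonpos in auto)
qed

text \<open>The bound is uniform over the first \<open>K\<close> discs, so a single large
  \<open>n\<close> makes the damping harmless on all of them.\<close>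

lemma Ln_bound_tangent_disc:
  assumes z: "z \<in> tangent_disc k" and "k < K"
  shows "cmod (Ln (1 - z)) \<le> 4 + ln (4 ^ Suc K)"
proof -
  have zD: "z \<in> ball 0 1" by (rule tangent_discD(4)[OF z])
  then have nz: "1 - z \<noteq> 0" by auto
  have "(1::real) / 4 ^ Suc K \<le> 1 / 4 ^ Suc k"
    using \<open>k < K\<close> by (intro divide_left_mono power_increasing) auto
  then have ge: "1 / 4 ^ Suc K < cmod (1 - z)" using tangent_discD(1)[OF z] by simp
  have "ln (1 / 4 ^ Suc K) < ln (cmod (1 - z))"
    using ge nz by (subst ln_less_cancel_iff) auto
  then have "- ln (cmod (1 - z)) \<le> ln (4 ^ Suc K)" by (simp add: ln_div del: power_Suc)
  moreover have "ln (cmod (1 - z)) \<le> 0"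
  proof -
    have "(1::real) / 4 ^ k \<le> 1" by simp
    then have "cmod (1 - z) \<le> 1" using tangent_discD(2)[OF z] by linarith
    then show ?thesis using nz by simp
  qed
  ultimately have "\<bar>Re (Ln (1 - z))\<bar> \<le> ln (4 ^ Suc K)" using nz by (simp add: Re_Ln del: power_Suc)
  then show ?thesis using Im_Ln_disc[OF zD] cmod_le[of "Ln (1 - z)"] by linarith
qed

section \<open>Divergence and concentration of the test sequence\<close>

theorem proposition1:
  fixes c :: real and f :: bergman
  assumes "c > 0"
    and "\<And>z. z \<in> ball 0 1 \<Longrightarrow> z \<noteq> 0 \<Longrightarrow>
           bergman_fun f z = complex_of_real c * z\<^sup>2 / ((1 - z)\<^sup>2 * (Ln (1 - z))\<^sup>2)"
    and "norm f = 1"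
  shows "\<not> strongly_exposed f"
proof -
  define q where "q n z = damped_square n (Ln (1 - z))" for n z
  define u where "u n = bergman_mult (q n) f" for n
  have hol: "q n holomorphic_on ball 0 1" for n
    unfolding q_def by (rule damped_square_Ln_holomorphic)
  have bound: "cmod (q n z) \<le> 3 * real (n + 8)" if "z \<in> ball 0 1" for n z
    unfolding q_def by (rule strip_bounds(2)[OF Im_Ln_disc[OF that]])
  have u: "bergman_fun (u n) = (\<lambda>z. q n z * bergman_fun f z)" for n
    unfolding u_def by (rule bergman_fun_mult[OF hol bound])
  have uz: "bergman_fun (u n) z = of_real c * z\<^sup>2 / ((1 - z)\<^sup>2 * (1 + (Ln (1 - z))\<^sup>2 / of_nat (n + 8)))"
    if z: "z \<in> ball 0 1" for n z
  proof (cases "z = 0")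
    case True
    then show ?thesis by (simp add: u q_def damped_square_def)
  next
    case False
    then show ?thesis
      using Ln_disc_nonzero[OF z] assms(2)[OF z] by (simp add: u q_def damped_square_def)
  qed
  show ?thesis
  proof (rule not_strongly_exposedI)
    show "Re (L (u n)) \<ge> norm (u n) - 32"
      if "bounded_linear L" "onorm L = 1" "L f = (1::complex)" for L n
      unfolding u_def
      by (rule support_functional_mult_ge[OF that assms(3) hol bound])
         (auto simp: q_def intro!: strip_bounds(3) Im_Ln_disc)
    show lim: "filterlim (\<lambda>n. norm (u n)) at_top sequentially"
      unfolding filterlim_at_top
    proof
      fix M :: real
      \<comment> \<open>288 is 32 * 9: 32 from \<open>cmod z \<ge> 1 / 4\<close> and a denominator
        of modulus at most 2, 9 from \<open>bergman_norm_ge_tangent_discs\<close>.\<close>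
      obtain K :: nat where K: "real K \<ge> M / (c / 288)" using real_arch_simple by blast
      define B where "B = (4 + ln (4 ^ Suc K :: real))\<^sup>2"
      obtain n0 :: nat where n0: "real n0 \<ge> B" using real_arch_simple by blast
      show "\<forall>\<^sub>F n in sequentially. M \<le> norm (u n)"
        using eventually_ge_at_top[of n0]
      proof eventually_elim
        case (elim n)
        have "cmod (bergman_fun (u n) z) \<ge> c / 32 / (cmod (1 - z))\<^sup>2"
          if k: "k < K" and z: "z \<in> tangent_disc k" for k z
        proof -
          let ?d = "1 + (Ln (1 - z))\<^sup>2 / of_nat (n + 8)"
          note zD = tangent_discD(4)[OF z]
          have "cmod ?d \<le> 1 + (cmod (Ln (1 - z)))\<^sup>2 / real (n + 8)"
            using norm_triangle_ineq[of 1 "(Ln (1 - z))\<^sup>2 / of_nat (n + 8)"]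
            by (simp add: norm_divide norm_power del: of_nat_add)
          also have "\<dots> \<le> 1 + B / real (n + 8)"
            unfolding B_def
            using Ln_bound_tangent_disc[OF z k] by (intro add_left_mono divide_right_mono power_mono) auto
          also have "1 + B / real (n + 8) \<le> 2"
            using n0 elim by simp
          finally have d: "cmod ?d \<le> 2" by simp
          have d0: "cmod ?d > 0"
            using strip_bounds(1)[OF Im_Ln_disc[OF zD], of n] by linarith
          have "(1 / 4)\<^sup>2 \<le> (cmod z)\<^sup>2" using tangent_discD(3)[OF z] by (intro power_mono) auto
          then have cz: "c * (1 / 16) \<le> c * (cmod z)\<^sup>2"
            using assms(1) by (intro mult_left_mono) (auto simp: power2_eq_square)
          have p: "(cmod (1 - z))\<^sup>2 > 0" using zD by auto
          have "c / 32 / (cmod (1 - z))\<^sup>2 = c * (1 / 16) / ((cmod (1 - z))\<^sup>2 * 2)" by simp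
          also have "\<dots> \<le> c * (cmod z)\<^sup>2 / ((cmod (1 - z))\<^sup>2 * cmod ?d)"
            using cz d d0 p assms(1) by (intro frac_le mult_left_mono) auto
          also have "\<dots> = cmod (bergman_fun (u n) z)"
            using assms(1) by (simp add: uz[OF zD] norm_mult norm_divide norm_power)
          finally show ?thesis .
        qed
        then have "norm (u n) \<ge> real K * (c / 32 / 9)"
          using assms(1) by (intro bergman_norm_ge_tangent_discs) auto
        then show ?case using K assms(1) by (simp add: field_simps)
      qed
    qed
    \<comment> \<open>This bounded operator removes the singularity at 1: it sends the
      \<open>u n\<close> to a bounded sequence, hence their normalizations to 0, whereas
      \<open>?m f\<close> is not 0.\<close>
    let ?m = "bergman_mult (\<lambda>z. (1 - z)\<^sup>2)"
    have holm: "(\<lambda>z. (1 - z)\<^sup>2) holomorphic_on ball (0::complex) 1" by (intro holomorphic_intros)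
    have boundm: "cmod ((1 - z)\<^sup>2) \<le> 4" if "z \<in> ball 0 1" for z
    proof -
      have "cmod (1 - z) \<le> 2" using norm_triangle_ineq4[of 1 z] that by simp
      then show ?thesis using power_mono[of "cmod (1 - z)" 2 2] by (simp add: norm_power)
    qed
    have m: "bergman_fun (?m g) = (\<lambda>z. (1 - z)\<^sup>2 * bergman_fun g z)" for g
      by (rule bergman_fun_mult[OF holm boundm])
    show "\<not> (\<lambda>n. norm (u n /\<^sub>R norm (u n) - f)) \<longlonglongrightarrow> 0"
    proof
      assume conv: "(\<lambda>n. norm (u n /\<^sub>R norm (u n) - f)) \<longlonglongrightarrow> 0"
      have mu: "norm (?m (u n)) \<le> 2 * c" for n
      proof (rule bergman_norm_le_bound)
        fix z :: complex assume z: "z \<in> ball 0 1"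
        let ?d = "1 + (Ln (1 - z))\<^sup>2 / of_nat (n + 8)"
        have "z \<noteq> 1" using z by auto
        then have "bergman_fun (?m (u n)) z = of_real c * z\<^sup>2 / ?d"
          by (simp add: m uz[OF z] del: of_nat_add)
        then have "cmod (bergman_fun (?m (u n)) z) = c * (cmod z)\<^sup>2 / cmod ?d"
          using assms(1) by (simp add: norm_mult norm_divide norm_power)
        also have "\<dots> \<le> c * 1 / (1 / 2)"
          using assms(1) z strip_bounds(1)[OF Im_Ln_disc[OF z], of n]
          by (intro frac_le mult_left_mono) (auto simp: power_le_one)
        finally show "cmod (bergman_fun (?m (u n)) z) \<le> 2 * c" by simp
      qed
      have le: "norm (?m f) \<le> 2 * c * inverse (norm (u n)) + 4 * norm (u n /\<^sub>R norm (u n) - f)" for n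
      proof -
        let ?v = "u n /\<^sub>R norm (u n)"
        \<comment> \<open>Linearity of \<open>?m\<close>, with
          \<open>f = ?v - (?v - f)\<close>.\<close>
        have "?m f = inverse (norm (u n)) *\<^sub>R ?m (u n) - ?m (?v - f)"
          by (rule bergman_fun_inject[THEN iffD1])
             (simp add: m minus_bergman.rep_eq scaleR_bergman.rep_eq algebra_simps fun_eq_iff)
        also have "norm \<dots> \<le> norm (inverse (norm (u n)) *\<^sub>R ?m (u n)) + norm (?m (?v - f))"
          by (rule norm_triangle_ineq4)
        also have "\<dots> \<le> 2 * c * inverse (norm (u n)) + 4 * norm (?v - f)"
        proof (rule add_mono)
          show "norm (inverse (norm (u n)) *\<^sub>R ?m (u n)) \<le> 2 * c * inverse (norm (u n))"
            using mult_left_mono[OF mu[of n], of "inverse (norm (u n))"] by (simp add: mult.commute)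
          show "norm (?m (?v - f)) \<le> 4 * norm (?v - f)"
            by (rule bergman_norm_mult_le[OF holm boundm])
        qed
        finally show ?thesis .
      qed
      have "(\<lambda>n. 2 * c * inverse (norm (u n)) + 4 * norm (u n /\<^sub>R norm (u n) - f)) \<longlonglongrightarrow> 2 * c * 0 + 4 * 0"
        by (intro tendsto_intros conv tendsto_inverse_0_at_top lim)
      then have "norm (?m f) \<le> 2 * c * 0 + 4 * 0"
        by (rule LIMSEQ_le_const) (use le in blast)
      then have "?m f = 0" by simp
      \<comment> \<open>The explicit formula, valid at \<open>1 / 2\<close>, shows that
        \<open>f\<close> is nonzero there.\<close>
      then have "bergman_fun (?m f) (1 / 2) = 0" by (simp add: zero_bergman.rep_eq)
      then show False
        using assms(1) Ln_disc_nonzero[of "1 / 2"] by (simp add: m assms(2) norm_divide)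
    qed
  qed
qed

end
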